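(* Let $\lambda_2\oplus\mathbb{C}=\mu_1\oplus\mathbb{C}^2$ be the $4$-dimensional complex Leibniz algebra with basis $e_1,\dots,e_4$ and only nonzero bracket $[e_1,e_1]=e_3$. Then it deforms to the metric Leibniz algebras $\mu_1\oplus\mu_1$, $\mathfrak{L}_2$ and $\mathfrak{R}_{20}(0)$, where: $\mu_1$ has basis $e_1,e_2$ and only nonzero bracket $[e_1,e_1]=e_2$; $\mathfrak{L}_2$ has basis $e_1,\dots,e_4$ and nonzero brackets $[e_1,e_2]=e_3=-[e_2,e_1]$, $[e_1,e_4]=e_1=-[e_4,e_1]$, $[e_4,e_2]=e_2=-[e_2,e_4]$, $[e_4,e_4]=e_3$; and $\mathfrak{R}_{20}(0)$ has basis $e_1,\dots,e_4$ and nonzero brackets $[e_1,e_2]=e_4$, $[e_2,e_1]=e_4$, $[e_2,e_2]=e_3$.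
   Context: All algebras are over $\mathbb{C}$. A left (resp. right) Leibniz algebra is a vector space $\mathfrak{L}$ with a bilinear bracket satisfying $[x,[y,z]]=[[x,y],z]+[y,[x,z]]$ (resp. $[x,[y,z]]=[[x,y],z]-[[x,z],y]$); a Leibniz algebra is one or the other. A bilinear form $B$ on $\mathfrak{L}$ is invariant if $B([x,y],z)=B(x,[y,z])$ for all $x,y,z$. $\mathfrak{L}$ is metric if it has a non-degenerate symmetric invariant bilinear form. A (formal $1$-parameter, Leibniz) deformation of $(\mathfrak{L},\mu_0)$ is a Leibniz bracket $\mu_t=\mu_0+t\phi_1+t^2\phi_2+\cdots$ on $\mathfrak{L}\otimes\mathbb{C}[[t]]$, with $\phi_i$ bilinear maps $\mathfrak{L}\times\mathfrak{L}\to\mathfrak{L}$. $\mathfrak{L}$ deforms to a Leibniz algebra $\mathfrak{N}$ if there is a deformation $\mu_t$, polynomial in $t$, such that $(\mathfrak{L},\mu_t)\cong\mathfrak{N}$ for all nonzero $t$ near $0$. *)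

theory Defs
  imports "HOL-Analysis.Analysis" "HOL-Computational_Algebra.Formal_Power_Series"
begin

text \<open>
  An algebra of dimension \<open>CARD('n)\<close> over a commutative ring \<open>'a\<close> is a bracket on the free module
  \<open>'a ^ 'n\<close>. The ring is \<open>complex\<close> for ordinary algebras, and \<open>complex fps\<close> for brackets on
  \<open>L \<otimes> C[[t]]\<close>, which is \<open>complex fps ^ 'n\<close> when \<open>L\<close> is \<open>complex ^ 'n\<close>.
\<close>

definition bilin ::
  "('a::comm_ring_1 \<Rightarrow> 'u::ab_group_add \<Rightarrow> 'u) \<Rightarrow> ('a \<Rightarrow> 'v::ab_group_add \<Rightarrow> 'v) \<Rightarrow>
   ('a \<Rightarrow> 'w::ab_group_add \<Rightarrow> 'w) \<Rightarrow> ('u \<Rightarrow> 'v \<Rightarrow> 'w) \<Rightarrow> bool" where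
  "bilin s1 s2 s3 f \<longleftrightarrow>
     (\<forall>x. module_hom s2 s3 (\<lambda>y. f x y)) \<and> (\<forall>y. module_hom s1 s3 (\<lambda>x. f x y))"

type_synonym ('a, 'n) bracket = "'a ^ 'n \<Rightarrow> 'a ^ 'n \<Rightarrow> 'a ^ 'n"

definition bilinear_bracket :: "('a::comm_ring_1, 'n::finite) bracket \<Rightarrow> bool" where
  "bilinear_bracket br \<longleftrightarrow> bilin (*s) (*s) (*s) br"

definition left_leibniz :: "('a::comm_ring_1, 'n::finite) bracket \<Rightarrow> bool" where
  "left_leibniz br \<longleftrightarrow> bilinear_bracket br \<and>
     (\<forall>x y z. br x (br y z) = br (br x y) z + br y (br x z))"

definition right_leibniz :: "('a::comm_ring_1, 'n::finite) bracket \<Rightarrow> bool" where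
  "right_leibniz br \<longleftrightarrow> bilinear_bracket br \<and>
     (\<forall>x y z. br x (br y z) = br (br x y) z - br (br x z) y)"

definition leibniz :: "('a::comm_ring_1, 'n::finite) bracket \<Rightarrow> bool" where
  "leibniz br \<longleftrightarrow> left_leibniz br \<or> right_leibniz br"

definition metric_leibniz :: "(complex, 'n::finite) bracket \<Rightarrow> bool" where
  "metric_leibniz br \<longleftrightarrow> leibniz br \<and>
     (\<exists>B :: complex ^ 'n \<Rightarrow> complex ^ 'n \<Rightarrow> complex.
        bilin (*s) (*s) (*) B \<and>
        (\<forall>x y. B x y = B y x) \<and>
        (\<forall>x y z. B (br x y) z = B x (br y z)) \<and>
        (\<forall>x. (\<forall>y. B x y = 0) \<longrightarrow> x = 0))"

definition isomorphic_alg ::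
  "(complex, 'n::finite) bracket \<Rightarrow> (complex, 'm::finite) bracket \<Rightarrow> bool" where
  "isomorphic_alg br br' \<longleftrightarrow>
     (\<exists>f. Vector_Spaces.linear (*s) (*s) f \<and> bij f \<and> (\<forall>x y. f (br x y) = br' (f x) (f y)))"

text \<open>The map \<open>L \<rightarrow> L \<otimes> C[[t]]\<close>, \<open>x \<mapsto> x \<otimes> 1\<close>.\<close>

definition const_vec :: "complex ^ 'n::finite \<Rightarrow> complex fps ^ 'n" where
  "const_vec x = (\<chi> i. fps_const (vec_nth x i))"

text \<open>
  \<open>M\<close> is the deformation \<open>\<phi> 0 + t \<phi> 1 + t\<^sup>2 \<phi> 2 + \<dots>\<close> of \<open>br\<close>. Since \<open>M\<close> is \<open>C[[t]]\<close>-bilinear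
  (part of \<open>leibniz\<close>), it is determined by its values on \<open>L\<close>, where it is given by this series.
\<close>

definition formal_deformation ::
  "(complex, 'n::finite) bracket \<Rightarrow> (nat \<Rightarrow> (complex, 'n) bracket) \<Rightarrow>
   (complex fps, 'n) bracket \<Rightarrow> bool" where
  "formal_deformation br \<phi> M \<longleftrightarrow>
     \<phi> 0 = br \<and> (\<forall>k. bilinear_bracket (\<phi> k)) \<and> leibniz M \<and>
     (\<forall>x y. M (const_vec x) (const_vec y) = (\<chi> i. Abs_fps (\<lambda>k. vec_nth (\<phi> k x y) i)))"

definition deforms_to ::
  "(complex, 'n::finite) bracket \<Rightarrow> (complex, 'm::finite) bracket \<Rightarrow> bool" where
  "deforms_to br br' \<longleftrightarrow> leibniz br \<and> leibniz br' \<and>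
     (\<exists>\<phi> M d. formal_deformation br \<phi> M \<and>
        (\<forall>k>d. \<phi> k = (\<lambda>x y. 0)) \<and>
        (\<forall>\<^sub>F t in at 0. isomorphic_alg (\<lambda>x y. \<Sum>k\<le>d. t ^ k *s \<phi> k x y) br'))"

definition direct_sum_alg ::
  "(complex, 'n::finite) bracket \<Rightarrow> (complex, 'm::finite) bracket \<Rightarrow> (complex, 'n + 'm) bracket" where
  "direct_sum_alg br br' x y =
     (\<chi> k. case k of
        Inl i \<Rightarrow> vec_nth (br (\<chi> j. vec_nth x (Inl j)) (\<chi> j. vec_nth y (Inl j))) i
      | Inr i \<Rightarrow> vec_nth (br' (\<chi> j. vec_nth x (Inr j)) (\<chi> j. vec_nth y (Inr j))) i)"

definition bvec :: "'n::finite \<Rightarrow> complex ^ 'n" where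
  "bvec i = axis i 1"

text \<open>
  The algebra with basis \<open>bvec i\<close> in which \<open>[bvec i, bvec j] = v\<close> for each table entry \<open>((i, j), v)\<close>, and
  the brackets of basis vectors not listed vanish. In the numeral type \<open>4\<close> the index \<open>4\<close> is \<open>0\<close>
  (and \<open>2\<close> is \<open>0\<close> in the type \<open>2\<close>); \<open>1, 2, 3, 4\<close> are its four distinct elements.
\<close>

definition table_alg :: "(('n \<times> 'n) \<times> (complex ^ 'n)) list \<Rightarrow> (complex, 'n::finite) bracket" where
  "table_alg tab x y = (\<Sum>i\<in>UNIV. \<Sum>j\<in>UNIV. (vec_nth x i * vec_nth y j) *s
     (case map_of tab (i, j) of None \<Rightarrow> 0 | Some v \<Rightarrow> v))"

definition mu1 :: "(complex, 2) bracket" where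
  "mu1 = table_alg [((1, 1), bvec 2)]"

definition lambda2_C :: "(complex, 4) bracket" where
  "lambda2_C = table_alg [((1, 1), bvec 3)]"

definition L2 :: "(complex, 4) bracket" where
  "L2 = table_alg
     [((1, 2), bvec 3), ((2, 1), - bvec 3), ((1, 4), bvec 1), ((4, 1), - bvec 1),
      ((4, 2), bvec 2), ((2, 4), - bvec 2), ((4, 4), bvec 3)]"

definition R20_0 :: "(complex, 4) bracket" where
  "R20_0 = table_alg [((1, 2), bvec 4), ((2, 1), bvec 4), ((2, 2), bvec 3)]"

text \<open>\<open>lambda2_C\<close> is, up to isomorphism, the direct sum of \<open>mu1\<close> and the abelian algebra \<open>C\<^sup>2\<close>.\<close>

lemma lambda2_C_iso_mu1_sum_abelian:
  "isomorphic_alg lambda2_C (direct_sum_alg mu1 ((\<lambda>x y. 0) :: (complex, 2) bracket))"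
proof -
  define f :: "complex ^ 4 \<Rightarrow> complex ^ (2 + 2)" where
    "f x = (\<chi> k. case k of Inl i \<Rightarrow> if i = 1 then vec_nth x 1 else vec_nth x 3
                        | Inr i \<Rightarrow> if i = 1 then vec_nth x 2 else vec_nth x 4)" for x
  define g :: "complex ^ (2 + 2) \<Rightarrow> complex ^ 4" where
    "g x = (\<chi> k. if k = 1 then vec_nth x (Inl 1) else if k = 3 then vec_nth x (Inl 2)
                else if k = 2 then vec_nth x (Inr 1) else vec_nth x (Inr 2))" for x
  have all_sum: "(\<forall>k::2 + 2. P k) \<longleftrightarrow> P (Inl 1) \<and> P (Inl 2) \<and> P (Inr 1) \<and> P (Inr 2)" for P
    by (simp add: split_sum_all forall_2)
  have "Vector_Spaces.linear (*s) (*s) f"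
    by unfold_locales (simp_all add: vec_eq_iff f_def all_sum distrib_left distrib_right)
  moreover have "bij f"
  proof (rule o_bij)
    show "g \<circ> f = id"
      by (auto simp: fun_eq_iff vec_eq_iff f_def g_def forall_4)
    show "f \<circ> g = id"
      by (auto simp: fun_eq_iff vec_eq_iff f_def g_def all_sum)
  qed
  moreover have "f (lambda2_C x y) = direct_sum_alg mu1 (\<lambda>x y. 0) (f x) (f y)" for x y
    by (simp add: vec_eq_iff all_sum lambda2_C_def mu1_def table_alg_def sum_4 sum_2 bvec_def
          axis_def direct_sum_alg_def f_def)
  ultimately show ?thesis
    unfolding isomorphic_alg_def by blast
qed

end

theory Submission
  imports Defs
begin

text \<open>
  All three deformations are linear in \<open>t\<close>, and their brackets are given by the same formulas over
  \<open>complex\<close> and over \<open>complex fps\<close>: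
  \<open>[e\<^sub>1, e\<^sub>1] = e\<^sub>3\<close> together with \<open>[e\<^sub>2, e\<^sub>2] = t e\<^sub>4\<close>;
  with \<open>[e\<^sub>1, e\<^sub>2] = [e\<^sub>2, e\<^sub>1] = t e\<^sub>4\<close>;
  and with the antisymmetric brackets
  \<open>[e\<^sub>1, e\<^sub>2] = t e\<^sub>2\<close>, \<open>[e\<^sub>4, e\<^sub>1] = t e\<^sub>4\<close>, \<open>[e\<^sub>4, e\<^sub>2] = t e\<^sub>3\<close>.
  For \<open>t \<noteq> 0\<close> a permutation and rescaling of the basis gives \<open>\<mu>\<^sub>1 \<oplus> \<mu>\<^sub>1\<close>, \<open>R\<^sub>2\<^sub>0(0)\<close> and \<open>L\<^sub>2\<close>.
\<close>

lemma bilinear_bracketI: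
  assumes "\<And>x y z. br x (y + z) = br x y + br x z" "\<And>x y z. br (x + y) z = br x z + br y z"
    and "\<And>c x y. br x (c *s y) = c *s br x y" "\<And>c x y. br (c *s x) y = c *s br x y"
  shows "bilinear_bracket br"
  unfolding bilinear_bracket_def bilin_def
  by (intro conjI allI; unfold_locales) (simp_all add: assms vec_eq_iff algebra_simps)

text \<open>Every bracket treated here, over either ring, satisfies the left identity, so the left
  alternative of \<open>leibniz\<close> is enough.\<close>

lemma leibnizI:
  assumes "\<And>x y z. br x (y + z) = br x y + br x z" "\<And>x y z. br (x + y) z = br x z + br y z"
    and "\<And>c x y. br x (c *s y) = c *s br x y" "\<And>c x y. br (c *s x) y = c *s br x y"
    and "\<And>x y z. br x (br y z) = br (br x y) z + br y (br x z)"
  shows "leibniz br"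
  unfolding leibniz_def left_leibniz_def
  using bilinear_bracketI[of br, OF assms(1-4)] assms(5) by blast

text \<open>Symmetry transfers linearity from the second argument to the first. An element of the
  radical is in particular orthogonal to the basis vectors, so testing these suffices.\<close>

lemma metric_leibnizI:
  fixes B :: "complex ^ 'n \<Rightarrow> complex ^ 'n \<Rightarrow> complex"
  assumes "leibniz br"
    and "\<And>x y. B x y = B y x" "\<And>x y z. B x (y + z) = B x y + B x z"
    and "\<And>c x y. B x (c *s y) = c * B x y"
    and "\<And>x y z. B (br x y) z = B x (br y z)" "\<And>x. (\<And>i. B x (axis i 1) = 0) \<Longrightarrow> x = 0"
  shows "metric_leibniz br"
proof -
  have "B (x + y) z = B x z + B y z" "B (c *s x) y = c * B x y" for x y z c
    using assms(2-4) by metis+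
  then have "bilin (*s) (*s) (*) B"
    unfolding bilin_def
    by (intro conjI allI; unfold_locales) (simp_all add: assms(3,4) vec_eq_iff algebra_simps)
  then show ?thesis
    unfolding metric_leibniz_def using assms(1,2,5,6) by blast
qed

lemma isomorphic_algI:
  assumes "\<And>x y. f (x + y) = f x + f y" "\<And>c x. f (c *s x) = c *s f x"
    and "\<And>x. g (f x) = x" "\<And>y. f (g y) = y" "\<And>x y. f (br x y) = br' (f x) (f y)"
  shows "isomorphic_alg br br'"
proof -
  have "Vector_Spaces.linear (*s) (*s) f"
    by unfold_locales (simp_all add: assms(1,2) vec_eq_iff algebra_simps)
  moreover have "bij f"
    by (rule o_bij[of g]) (simp_all add: fun_eq_iff assms(3,4))
  ultimately show ?thesis
    unfolding isomorphic_alg_def using assms(5) by blast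
qed

text \<open>The series stops at \<open>d = 1\<close>. The bracket \<open>M\<close> over
  \<open>complex fps\<close> is tied to \<open>br\<close> and \<open>br1\<close> through its values
  on constant vectors, where \<open>fps_X\<close> stands for t.\<close>

lemma deforms_to_linear:
  fixes br br1 :: "(complex, 'n::finite) bracket"
  assumes "leibniz br" "leibniz br'" "leibniz M" "bilinear_bracket br1"
    and M: "\<And>x y i. M (const_vec x) (const_vec y) $ i
              = fps_const (br x y $ i) + fps_X * fps_const (br1 x y $ i)"
    and iso: "\<And>t. t \<noteq> 0 \<Longrightarrow> isomorphic_alg (\<lambda>x y. br x y + t *s br1 x y) br'"
  shows "deforms_to br br'"
proof -
  define \<phi> where "\<phi> k = (if k = 0 then br else if k = 1 then br1 else (\<lambda>x y. 0))" for k :: nat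
  have "bilinear_bracket br"
    using assms(1) unfolding leibniz_def left_leibniz_def right_leibniz_def by blast
  moreover have "bilinear_bracket (\<lambda>x y. 0 :: complex ^ 'n)"
    by (rule bilinear_bracketI) simp_all
  ultimately have "\<forall>k. bilinear_bracket (\<phi> k)"
    using assms(4) by (simp add: \<phi>_def)
  moreover have "M (const_vec x) (const_vec y) = (\<chi> i. Abs_fps (\<lambda>k. \<phi> k x y $ i))" for x y
    by (auto simp: vec_eq_iff fps_eq_iff M \<phi>_def)
  ultimately have "formal_deformation br \<phi> M"
    using assms(3) by (simp add: formal_deformation_def \<phi>_def)
  moreover have "\<forall>k>1. \<phi> k = (\<lambda>x y. 0)"
    by (simp add: \<phi>_def)
  moreover have "isomorphic_alg (\<lambda>x y. \<Sum>k\<le>1. t ^ k *s \<phi> k x y) br'" if "t \<noteq> 0" for t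
    using iso[OF that] by (simp add: \<phi>_def)
  then have "\<forall>\<^sub>F t in at 0. isomorphic_alg (\<lambda>x y. \<Sum>k\<le>1. t ^ k *s \<phi> k x y) br'"
    by (simp add: eventually_at_filter)
  ultimately show ?thesis
    unfolding deforms_to_def using assms(1,2) by blast
qed

text \<open>Polymorphic, so that the same coordinate formulas can be written over
  \<open>complex\<close> and \<open>complex fps\<close>. The last \<open>else\<close> is the index
  4, which is 0 in the type \<open>4\<close>.\<close>

definition vec4 :: "'a \<Rightarrow> 'a \<Rightarrow> 'a \<Rightarrow> 'a \<Rightarrow> 'a ^ 4" where
  "vec4 a b c d = (\<chi> i. if i = 1 then a else if i = 2 then b else if i = 3 then c else d)"

lemma vec4_nth [simp]:
  "vec4 a b c d $ 1 = a" "vec4 a b c d $ 2 = b" "vec4 a b c d $ 3 = c" "vec4 a b c d $ 4 = d"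
  by (simp_all add: vec4_def)

lemma vec4_eq_iff: "x = y \<longleftrightarrow> x $ 1 = y $ 1 \<and> x $ 2 = y $ 2 \<and> x $ 3 = y $ 3 \<and> x $ 4 = y $ 4"
  for x y :: "'a ^ 4"
  by (simp add: vec_eq_iff forall_4)

lemma vec22_eq_iff: "x = y \<longleftrightarrow> x $ Inl 1 = y $ Inl 1 \<and> x $ Inl 2 = y $ Inl 2 \<and>
    x $ Inr 1 = y $ Inr 1 \<and> x $ Inr 2 = y $ Inr 2"
  for x y :: "'a ^ (2 + 2)"
  by (simp add: vec_eq_iff split_sum_all forall_2)

text \<open>Once the tables are expanded like this, the identities to be checked become polynomial
  identities between coordinates.\<close>

lemma lambda2_C_eq: "lambda2_C x y = vec4 0 0 (x $ 1 * y $ 1) 0"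
  by (simp add: vec4_eq_iff lambda2_C_def table_alg_def sum_4 bvec_def axis_def)

lemma L2_eq: "L2 x y = vec4 (x $ 1 * y $ 4 - x $ 4 * y $ 1) (x $ 4 * y $ 2 - x $ 2 * y $ 4)
    (x $ 1 * y $ 2 - x $ 2 * y $ 1 + x $ 4 * y $ 4) 0"
  by (simp add: vec4_eq_iff L2_def table_alg_def sum_4 bvec_def axis_def)

lemma R20_0_eq: "R20_0 x y = vec4 0 0 (x $ 2 * y $ 2) (x $ 1 * y $ 2 + x $ 2 * y $ 1)"
  by (simp add: vec4_eq_iff R20_0_def table_alg_def sum_4 bvec_def axis_def)

lemma mu1_mu1_nth:
  "direct_sum_alg mu1 mu1 x y $ Inl 1 = 0" "direct_sum_alg mu1 mu1 x y $ Inr 1 = 0"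
  "direct_sum_alg mu1 mu1 x y $ Inl 2 = x $ Inl 1 * y $ Inl 1"
  "direct_sum_alg mu1 mu1 x y $ Inr 2 = x $ Inr 1 * y $ Inr 1"
  by (simp_all add: direct_sum_alg_def mu1_def table_alg_def sum_2 bvec_def axis_def)

lemma leibniz_lambda2_C: "leibniz lambda2_C"
  by (rule leibnizI) (simp_all add: lambda2_C_eq vec4_eq_iff algebra_simps)

lemma metric_mu1_mu1: "metric_leibniz (direct_sum_alg mu1 mu1)"
proof (rule metric_leibnizI)
  \<comment> \<open>Orthogonal sum of two hyperbolic planes: in each copy of \<open>mu1\<close> the
    generator is paired with its square.\<close>
  let ?B = "\<lambda>x y :: complex ^ (2 + 2). x $ Inl 1 * y $ Inl 2 + x $ Inl 2 * y $ Inl 1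
     + x $ Inr 1 * y $ Inr 2 + x $ Inr 2 * y $ Inr 1"
  show "leibniz (direct_sum_alg mu1 mu1)"
    by (rule leibnizI) (simp_all add: mu1_mu1_nth vec22_eq_iff algebra_simps)
  show "?B x y = ?B y x" "?B x (y + z) = ?B x y + ?B x z" "?B x (c *s y) = c * ?B x y"
    "?B (direct_sum_alg mu1 mu1 x y) z = ?B x (direct_sum_alg mu1 mu1 y z)" for x y z c
    by (simp_all add: mu1_mu1_nth algebra_simps)
  show "x = 0" if "\<And>i. ?B x (axis i 1) = 0" for x :: "complex ^ (2 + 2)"
    using that[of "Inl 1"] that[of "Inl 2"] that[of "Inr 1"] that[of "Inr 2"]
    by (simp add: vec22_eq_iff axis_def)
qed

lemma metric_L2: "metric_leibniz L2"
proof (rule metric_leibnizI)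
  \<comment> \<open>Both sides of invariance equal the determinant of the coordinates 1, 2, 4 of
    \<open>x\<close>, \<open>y\<close>, \<open>z\<close> plus
    \<open>x $ 4 * y $ 4 * z $ 4\<close>.\<close>
  let ?B = "\<lambda>x y :: complex ^ 4. x $ 3 * y $ 4 + x $ 4 * y $ 3 - x $ 1 * y $ 2 - x $ 2 * y $ 1"
  show "leibniz L2"
    by (rule leibnizI) (simp_all add: L2_eq vec4_eq_iff algebra_simps)
  show "?B x y = ?B y x" "?B x (y + z) = ?B x y + ?B x z" "?B x (c *s y) = c * ?B x y"
    "?B (L2 x y) z = ?B x (L2 y z)" for x y z c
    by (simp_all add: L2_eq algebra_simps)
  show "x = 0" if "\<And>i. ?B x (axis i 1) = 0" for x :: "complex ^ 4"
    using that[of 1] that[of 2] that[of 3] that[of 4] by (simp add: vec4_eq_iff axis_def)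
qed

lemma metric_R20_0: "metric_leibniz R20_0"
proof (rule metric_leibnizI)
  \<comment> \<open>Both sides of invariance are the symmetric trilinear form whose value at
    \<open>x\<close>, \<open>x\<close>, \<open>x\<close> is
    \<open>3 * x $ 1 * (x $ 2) ^ 2\<close>.\<close>
  let ?B = "\<lambda>x y :: complex ^ 4. x $ 1 * y $ 3 + x $ 3 * y $ 1 + x $ 2 * y $ 4 + x $ 4 * y $ 2"
  show "leibniz R20_0"
    by (rule leibnizI) (simp_all add: R20_0_eq vec4_eq_iff algebra_simps)
  show "?B x y = ?B y x" "?B x (y + z) = ?B x y + ?B x z" "?B x (c *s y) = c * ?B x y"
    "?B (R20_0 x y) z = ?B x (R20_0 y z)" for x y z c
    by (simp_all add: R20_0_eq algebra_simps)
  show "x = 0" if "\<And>i. ?B x (axis i 1) = 0" for x :: "complex ^ 4"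
    using that[of 1] that[of 2] that[of 3] that[of 4] by (simp add: vec4_eq_iff axis_def)
qed

lemma metric_leibniz_imp_leibniz: "metric_leibniz br \<Longrightarrow> leibniz br"
  by (simp add: metric_leibniz_def)

lemma deforms_mu1_mu1: "deforms_to lambda2_C (direct_sum_alg mu1 mu1)"
proof (rule deforms_to_linear)
  let ?M = "\<lambda>x y :: complex fps ^ 4. vec4 0 0 (x $ 1 * y $ 1) (fps_X * (x $ 2 * y $ 2))"
  let ?br1 = "\<lambda>x y :: complex ^ 4. vec4 0 0 0 (x $ 2 * y $ 2)"
  \<comment> \<open>Brackets depend on coordinates 1 and 2 and take values in coordinates 3 and 4,
    so all threefold brackets vanish.\<close>
  show "leibniz ?M"
    by (rule leibnizI) (simp_all add: vec4_eq_iff algebra_simps)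
  show "bilinear_bracket ?br1"
    by (rule bilinear_bracketI) (simp_all add: vec4_eq_iff algebra_simps)
  \<comment> \<open>Quantified over \<open>i\<close> so that \<open>forall_4\<close> can split into
    the four coordinates that \<open>vec4_nth\<close> evaluates.\<close>
  have "\<forall>i. ?M (const_vec x) (const_vec y) $ i
      = fps_const (lambda2_C x y $ i) + fps_X * fps_const (?br1 x y $ i)" for x y
    unfolding forall_4 by (simp add: const_vec_def lambda2_C_eq)
  then show "?M (const_vec x) (const_vec y) $ i
      = fps_const (lambda2_C x y $ i) + fps_X * fps_const (?br1 x y $ i)" for x y i
    by blast
  fix t :: complex assume "t \<noteq> 0"
  \<comment> \<open>The vectors e1, e3 span the first copy of \<open>mu1\<close>, and e2, t e4 the
    second.\<close>
  define f :: "complex ^ 4 \<Rightarrow> complex ^ (2 + 2)" where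
    "f x = (\<chi> k. case k of Inl i \<Rightarrow> if i = 1 then x $ 1 else x $ 3
                        | Inr i \<Rightarrow> if i = 1 then x $ 2 else x $ 4 / t)" for x
  have f: "f x $ Inl 1 = x $ 1" "f x $ Inl 2 = x $ 3" "f x $ Inr 1 = x $ 2" "f x $ Inr 2 = x $ 4 / t"
    for x by (simp_all add: f_def)
  show "isomorphic_alg (\<lambda>x y. lambda2_C x y + t *s ?br1 x y) (direct_sum_alg mu1 mu1)"
    by (rule isomorphic_algI[of f "\<lambda>y. vec4 (y $ Inl 1) (y $ Inr 1) (y $ Inl 2) (t * y $ Inr 2)"])
      (simp_all add: \<open>t \<noteq> 0\<close> f lambda2_C_eq mu1_mu1_nth vec4_eq_iff vec22_eq_iff field_simps)
qed (simp_all add: leibniz_lambda2_C metric_leibniz_imp_leibniz metric_mu1_mu1)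

lemma deforms_L2: "deforms_to lambda2_C L2"
proof (rule deforms_to_linear)
  let ?M = "\<lambda>x y :: complex fps ^ 4. vec4 0 (fps_X * (x $ 1 * y $ 2 - x $ 2 * y $ 1))
    (x $ 1 * y $ 1 + fps_X * (x $ 4 * y $ 2 - x $ 2 * y $ 4)) (fps_X * (x $ 4 * y $ 1 - x $ 1 * y $ 4))"
  let ?br1 = "\<lambda>x y :: complex ^ 4. vec4 0 (x $ 1 * y $ 2 - x $ 2 * y $ 1)
    (x $ 4 * y $ 2 - x $ 2 * y $ 4) (x $ 4 * y $ 1 - x $ 1 * y $ 4)"
  \<comment> \<open>The antisymmetric part is a Lie bracket. Adding [e1, e1] = e3 keeps the identity
    because e3 is central and no bracket has an e1 component.\<close>
  show "leibniz ?M"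
    by (rule leibnizI) (simp_all add: vec4_eq_iff algebra_simps)
  show "bilinear_bracket ?br1"
    by (rule bilinear_bracketI) (simp_all add: vec4_eq_iff algebra_simps)
  have "\<forall>i. ?M (const_vec x) (const_vec y) $ i
      = fps_const (lambda2_C x y $ i) + fps_X * fps_const (?br1 x y $ i)" for x y
    unfolding forall_4 by (simp add: const_vec_def lambda2_C_eq)
  then show "?M (const_vec x) (const_vec y) $ i
      = fps_const (lambda2_C x y $ i) + fps_X * fps_const (?br1 x y $ i)" for x y i
    by blast
  fix t :: complex assume "t \<noteq> 0"
  \<comment> \<open>The generators e1, e2, e3, e4 go to t e4, t^3 e2, t^2 e3, e1. The relations
    force the factors t on e1 and t^2 on e3, and the product t^3 of those on e2 and e4.\<close>
  then show "isomorphic_alg (\<lambda>x y. lambda2_C x y + t *s ?br1 x y) L2"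
    by (intro isomorphic_algI[of "\<lambda>x. vec4 (x $ 4) (t ^ 3 * x $ 2) (t ^ 2 * x $ 3) (t * x $ 1)"
          "\<lambda>y. vec4 (y $ 4 / t) (y $ 2 / t ^ 3) (y $ 3 / t ^ 2) (y $ 1)"])
      (simp_all add: lambda2_C_eq L2_eq vec4_eq_iff field_simps power2_eq_square power3_eq_cube)
qed (simp_all add: leibniz_lambda2_C metric_leibniz_imp_leibniz metric_L2)

lemma deforms_R20_0: "deforms_to lambda2_C R20_0"
proof (rule deforms_to_linear)
  let ?M = "\<lambda>x y :: complex fps ^ 4.
    vec4 0 0 (x $ 1 * y $ 1) (fps_X * (x $ 1 * y $ 2 + x $ 2 * y $ 1))"
  let ?br1 = "\<lambda>x y :: complex ^ 4. vec4 0 0 0 (x $ 1 * y $ 2 + x $ 2 * y $ 1)"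
  show "leibniz ?M"
    by (rule leibnizI) (simp_all add: vec4_eq_iff algebra_simps)
  show "bilinear_bracket ?br1"
    by (rule bilinear_bracketI) (simp_all add: vec4_eq_iff algebra_simps)
  have "\<forall>i. ?M (const_vec x) (const_vec y) $ i
      = fps_const (lambda2_C x y $ i) + fps_X * fps_const (?br1 x y $ i)" for x y
    unfolding forall_4 by (simp add: const_vec_def lambda2_C_eq)
  then show "?M (const_vec x) (const_vec y) $ i
      = fps_const (lambda2_C x y $ i) + fps_X * fps_const (?br1 x y $ i)" for x y i
    by blast
  fix t :: complex assume "t \<noteq> 0"
  \<comment> \<open>Swapping e1 and e2 moves the square e3 to its place in \<open>R20_0\<close>; the
    division by t normalises the mixed bracket.\<close>
  then show "isomorphic_alg (\<lambda>x y. lambda2_C x y + t *s ?br1 x y) R20_0"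
    by (intro isomorphic_algI[of "\<lambda>x. vec4 (x $ 2) (x $ 1) (x $ 3) (x $ 4 / t)"
          "\<lambda>y. vec4 (y $ 2) (y $ 1) (y $ 3) (t * y $ 4)"])
      (simp_all add: lambda2_C_eq R20_0_eq vec4_eq_iff field_simps)
qed (simp_all add: leibniz_lambda2_C metric_leibniz_imp_leibniz metric_R20_0)

theorem theorem4p5:
  shows "(metric_leibniz (direct_sum_alg mu1 mu1) \<and> deforms_to lambda2_C (direct_sum_alg mu1 mu1)) \<and>
         (metric_leibniz L2 \<and> deforms_to lambda2_C L2) \<and>
         (metric_leibniz R20_0 \<and> deforms_to lambda2_C R20_0)"
  by (simp add: metric_mu1_mu1 deforms_mu1_mu1 metric_L2 deforms_L2 metric_R20_0 deforms_R20_0)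

end
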